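(* Let $\beta\in(0,1)$ and let $L=L_\beta$. Let $n>2$ and $k$ with $1\leqslant k\leqslant n$ be integers such that $n$ is not divisible by $k$. Let $D$ be a domain with an algebraic boundary $\varGamma=\partial D$ of order $n$, and suppose that $\varGamma$ is defined by an equation $P(x,y)=c_0$ (that is, the polynomial $P-c_0$ defines $\varGamma$), where $P$ is a homogeneous polynomial of degree $n$ and $c_0$ is a constant. If $D$ is $L$-special and a pair of polynomials $(F_1,F_2)$ (polynomials in one complex variable with complex coefficients) is an admissible pair for $D$, then $\max(\deg F_1,\deg F_2)\neq n+k$.
   Context: Identify $\mathbb{R}^2$ with $\mathbb{C}$ via $z=x+iy$. Operator. For $\beta\in(0,1)$, $L_\beta=c\,\overline{\partial}\,\partial_\beta$, where $c\in\mathbb{C}\setminus\{0\}$, $\overline{\partial}=\frac12(\partial/\partial x+i\,\partial/\partial y)$ and $\partial_\beta=\frac12(\partial/\partial x+i\beta\,\partial/\partial y)$. Associated with $L_\beta$ is the real-linear transformation of the plane $T_\beta: z=x+iy\mapsto z_\beta=x+\frac{i}{\beta}y$. Carathéodory domains and the class $AC$. A bounded domain $D\subset\mathbb{R}^2$ is a Carathéodory domain if $\partial D=\partial D_\infty$, where $D_\infty$ is the unbounded connected component of $\mathbb{R}^2\setminus\overline{D}$; such a domain is simply connected. Let $\varphi$ be a conformal mapping of the unit disc $\mathbb{D}=\{|z|<1\}$ onto $D$. A holomorphic function $f$ in $D$ belongs to $AC(D)$ if $f\circ\varphi$ extends to a function that is continuous on $\overline{\mathbb{D}}$ and absolutely continuous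 on the unit circle. For $f\in AC(D)$ and an accessible boundary point $\zeta$ of $D$, the limits of $f$ along all paths lying in $D\cup\{\zeta\}$ and ending at $\zeta$ exist and are equal to a common value, denoted $f(\zeta)$ (the boundary value of $f$ at $\zeta$). $L$-special domains. For $L=L_\beta$, a Carathéodory domain $D$ is $L$-special if there exist two non-constant functions $F_1\in AC(D)$ and $F_2\in AC(T_\beta D)$ such that $F_1(\zeta)=F_2(T_\beta\zeta)$ for every accessible boundary point $\zeta\in\partial D$. Any such pair $(F_1,F_2)$ is called admissible for $D$ (it is not unique). Algebraic boundaries. A Jordan curve $\varGamma\subset\mathbb{R}^2$ is algebraic if $\varGamma\subset\{(x,y)\in\mathbb{R}^2:P(x,y)=0\}$ for some nonzero $P\in\mathbb{C}[x,y]$; in this case one says that $P$ defines $\varGamma$. The order of an algebraic curve $\varGamma$ is the smallest $n$ such that there is a polynomial of degree $n$ defining $\varGamma$. A domain with an algebraic boundary is a Jordan domain that is the interior of a closed Jordan algebraic curve; the order of the boundary is the order of this curve. Polynomials in $x,y$ and constants are allowed to be complex. *)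

theory Defs
  imports "HOL-Complex_Analysis.Complex_Analysis" "HOL-Computational_Algebra.Polynomial"
begin

text \<open>The plane is identified with \<^typ>\<open>complex\<close>. The operator \<open>L\<^sub>\<beta>\<close> enters only
  through its associated linear map:\<close>

definition T_beta :: "real \<Rightarrow> complex \<Rightarrow> complex" where
  "T_beta \<beta> z = Complex (Re z) (Im z / \<beta>)"


subsection \<open>Caratheodory domains\<close>

text \<open>For a bounded set in the plane, \<^const>\<open>outside\<close> is the unique unbounded connected
  component of its complement.\<close>

definition caratheodory_domain :: "complex set \<Rightarrow> bool" where
  "caratheodory_domain D \<longleftrightarrow>
     open D \<and> connected D \<and> D \<noteq> {} \<and> bounded D \<and>
     frontier D = frontier (outside (closure D))"


subsection \<open>The class AC and boundary values\<close>

text \<open>Since \<open>d\<close> is a division of a subset of \<^term>\<open>{a..b}\<close>, its members are finitely many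
  compact intervals with pairwise disjoint interiors; the interval \<open>k\<close> has the endpoints
  \<^term>\<open>Inf k\<close> and \<^term>\<open>Sup k\<close>.\<close>

definition abs_continuous_on_interval :: "real \<Rightarrow> real \<Rightarrow> (real \<Rightarrow> complex) \<Rightarrow> bool" where
  "abs_continuous_on_interval a b h \<longleftrightarrow>
     (\<forall>\<epsilon>>0. \<exists>\<delta>>0. \<forall>d s. d division_of s \<and> s \<subseteq> {a..b} \<and> (\<Sum>k\<in>d. Sup k - Inf k) < \<delta> \<longrightarrow>
        (\<Sum>k\<in>d. norm (h (Sup k) - h (Inf k))) < \<epsilon>)"

definition abs_continuous_on_unit_circle :: "(complex \<Rightarrow> complex) \<Rightarrow> bool" where
  "abs_continuous_on_unit_circle g \<longleftrightarrow> abs_continuous_on_interval 0 (2 * pi) (\<lambda>t. g (cis t))"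

definition conformal_disc_map :: "(complex \<Rightarrow> complex) \<Rightarrow> complex set \<Rightarrow> bool" where
  "conformal_disc_map \<phi> D \<longleftrightarrow>
     \<phi> holomorphic_on ball 0 1 \<and> inj_on \<phi> (ball 0 1) \<and> \<phi> ` ball 0 1 = D"

text \<open>The choice of \<open>\<phi>\<close> is immaterial: two such maps differ by a Moebius automorphism of the
  disc, which is smooth on the closed disc.\<close>

definition AC :: "complex set \<Rightarrow> (complex \<Rightarrow> complex) set" where
  "AC D = {f. f holomorphic_on D \<and>
     (\<exists>\<phi> g. conformal_disc_map \<phi> D \<and> continuous_on (cball 0 1) g \<and>
            (\<forall>z\<in>ball 0 1. g z = f (\<phi> z)) \<and> abs_continuous_on_unit_circle g)}"

definition access_path :: "complex set \<Rightarrow> complex \<Rightarrow> (real \<Rightarrow> complex) \<Rightarrow> bool" where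
  "access_path D \<zeta> \<gamma> \<longleftrightarrow> path \<gamma> \<and> \<gamma> ` {0..<1} \<subseteq> D \<and> pathfinish \<gamma> = \<zeta>"

definition accessible_points :: "complex set \<Rightarrow> complex set" where
  "accessible_points D = {\<zeta> \<in> frontier D. \<exists>\<gamma>. access_path D \<zeta> \<gamma>}"

text \<open>Meaningful for \<^term>\<open>f \<in> AC D\<close> and \<^term>\<open>\<zeta> \<in> accessible_points D\<close>, where the common
  limit exists and is unique.\<close>

definition boundary_value :: "complex set \<Rightarrow> (complex \<Rightarrow> complex) \<Rightarrow> complex \<Rightarrow> complex" where
  "boundary_value D f \<zeta> =
     (THE l. \<forall>\<gamma>. access_path D \<zeta> \<gamma> \<longrightarrow> ((\<lambda>t. f (\<gamma> t)) \<longlongrightarrow> l) (at_left 1))"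


subsection \<open>L-special domains\<close>

definition admissible_pair ::
    "real \<Rightarrow> complex set \<Rightarrow> (complex \<Rightarrow> complex) \<Rightarrow> (complex \<Rightarrow> complex) \<Rightarrow> bool" where
  "admissible_pair \<beta> D F1 F2 \<longleftrightarrow>
     F1 \<in> AC D \<and> F2 \<in> AC (T_beta \<beta> ` D) \<and>
     \<not> F1 constant_on D \<and> \<not> F2 constant_on (T_beta \<beta> ` D) \<and>
     (\<forall>\<zeta>\<in>accessible_points D.
        boundary_value D F1 \<zeta> = boundary_value (T_beta \<beta> ` D) F2 (T_beta \<beta> \<zeta>))"

definition L_special :: "real \<Rightarrow> complex set \<Rightarrow> bool" where
  "L_special \<beta> D \<longleftrightarrow> caratheodory_domain D \<and> (\<exists>F1 F2. admissible_pair \<beta> D F1 F2)"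


subsection \<open>Bivariate polynomials and algebraic curves\<close>

text \<open>A polynomial in \<open>x, y\<close> is represented in \<open>\<complex>[x][y]\<close>: the coefficient of
  \<open>x ^ i * y ^ j\<close> in \<open>P\<close> is \<^term>\<open>coeff (coeff P j) i\<close>.\<close>

definition eval_xy :: "complex poly poly \<Rightarrow> real \<Rightarrow> real \<Rightarrow> complex" where
  "eval_xy P x y = poly (poly P [:complex_of_real y:]) (complex_of_real x)"

definition total_degree :: "complex poly poly \<Rightarrow> nat" where
  "total_degree P = Max (insert 0 {i + j | i j. coeff (coeff P j) i \<noteq> 0})"

definition homogeneous_of_degree :: "nat \<Rightarrow> complex poly poly \<Rightarrow> bool" where
  "homogeneous_of_degree n P \<longleftrightarrow>
     P \<noteq> 0 \<and> (\<forall>i j. coeff (coeff P j) i \<noteq> 0 \<longrightarrow> i + j = n)"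

definition jordan_curve :: "complex set \<Rightarrow> bool" where
  "jordan_curve \<Gamma> \<longleftrightarrow>
     (\<exists>\<gamma>. simple_path \<gamma> \<and> pathfinish \<gamma> = pathstart \<gamma> \<and> path_image \<gamma> = \<Gamma>)"

definition defines_curve :: "complex poly poly \<Rightarrow> complex set \<Rightarrow> bool" where
  "defines_curve P \<Gamma> \<longleftrightarrow> P \<noteq> 0 \<and> \<Gamma> \<subseteq> {z. eval_xy P (Re z) (Im z) = 0}"

definition algebraic_jordan_curve :: "complex set \<Rightarrow> bool" where
  "algebraic_jordan_curve \<Gamma> \<longleftrightarrow> jordan_curve \<Gamma> \<and> (\<exists>P. defines_curve P \<Gamma>)"

definition curve_order :: "complex set \<Rightarrow> nat" where
  "curve_order \<Gamma> = (LEAST n. \<exists>P. defines_curve P \<Gamma> \<and> total_degree P = n)"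

text \<open>By the Jordan curve theorem, the curve \<open>\<Gamma>\<close> below is \<^term>\<open>frontier D\<close>.\<close>

definition algebraic_boundary_domain :: "complex set \<Rightarrow> bool" where
  "algebraic_boundary_domain D \<longleftrightarrow> (\<exists>\<Gamma>. algebraic_jordan_curve \<Gamma> \<and> D = inside \<Gamma>)"

end

theory Submission
  imports Defs "HOL-Computational_Algebra.Polynomial_Factorial" "HOL-Computational_Algebra.Field_as_Ring"
begin

text \<open>The polynomial \<open>G(x, y) = F1 (x + \<i>y) - F2 (x + \<i>y/\<beta>)\<close> vanishes on \<open>\<Gamma>\<close>. Since
  \<open>Q = P - c0\<close> has the least possible degree among the polynomials vanishing on \<open>\<Gamma>\<close> and has no
  vertical line as a component, it generates the ideal of \<open>\<Gamma>\<close>, so \<open>G = Q R\<close>. With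
  \<open>u = x + \<i>y\<close> and \<open>v = x + \<i>y/\<beta>\<close>, comparing the homogeneous parts of degrees \<open>k < n\<close> and
  \<open>n + k\<close> gives \<open>c0 (A u\<^sup>n\<^sup>+\<^sup>k - B v\<^sup>n\<^sup>+\<^sup>k) = - P (a u\<^sup>k - b v\<^sup>k)\<close>, where \<open>A, B\<close> and
  \<open>a, b\<close> are the coefficients of \<open>F1, F2\<close> in degrees \<open>n + k\<close> and \<open>k\<close>. If \<open>k\<close> does not divide \<open>n\<close>, this
  forces \<open>P\<close> to be a multiple of \<open>u\<^sup>n\<close> or of \<open>v\<^sup>n\<close>, and then \<open>\<Gamma>\<close> would be finite.\<close>

section \<open>Bivariate polynomials\<close>

text \<open>Complex arguments are allowed, unlike in \<open>eval_xy\<close>: slopes of lines and the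
  coordinates \<open>u\<close>, \<open>v\<close> below range over all complex numbers.\<close>

definition poly2 :: "complex poly poly \<Rightarrow> complex \<Rightarrow> complex \<Rightarrow> complex" where
  "poly2 A x y = poly (poly A [:y:]) x"

lemma eval_xy_conv_poly2: "eval_xy A x y = poly2 A (of_real x) (of_real y)"
  by (simp add: eval_xy_def poly2_def)

lemma poly2_simps [simp]:
  "poly2 0 x y = 0"
  "poly2 [:[:c:]:] x y = c"
  "poly2 (A + B) x y = poly2 A x y + poly2 B x y"
  "poly2 (A - B) x y = poly2 A x y - poly2 B x y"
  "poly2 (A * B) x y = poly2 A x y * poly2 B x y"
  "poly2 (A ^ m) x y = poly2 A x y ^ m"
  "poly2 (smult p A) x y = poly p x * poly2 A x y"
  "poly2 (\<Sum>i\<in>I. f i) x y = (\<Sum>i\<in>I. poly2 (f i) x y)"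
  by (simp_all add: poly2_def poly_sum)

lemma poly2_eq_sum:
  "poly2 A x y = (\<Sum>j\<le>degree A. poly (coeff A j) x * y ^ j)"
  by (simp add: poly2_def poly_altdef[of A] poly_sum)

text \<open>\<open>poly A [:0, b:]\<close> substitutes \<open>y = b x\<close>; it is the restriction
  of \<open>A\<close> to the line of slope \<open>b\<close>, as a polynomial in
  \<open>x\<close>.\<close>

lemma poly_line: "poly (poly A [:0, b:]) x = poly2 A x (b * x)"
  by (simp add: poly2_eq_sum poly_altdef[of A] poly_sum mult.commute)

lemma continuous_on_poly2 [continuous_intros]:
  assumes "continuous_on S f" "continuous_on S g"
  shows "continuous_on S (\<lambda>z. poly2 A (f z) (g z))"
  unfolding poly2_eq_sum by (intro continuous_intros assms)

definition vert_poly :: "complex poly poly \<Rightarrow> complex \<Rightarrow> complex poly" where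
  "vert_poly A x = map_poly (\<lambda>c. poly c x) A"

lemma poly_vert_poly: "poly (vert_poly A x) y = poly2 A x y"
  unfolding vert_poly_def poly2_def
  by (induction A) (simp_all add: map_poly_pCons algebra_simps)

lemma poly2_vertical:
  assumes "infinite {y. poly2 A x y = 0}"
  shows "poly2 A x y = 0"
proof -
  have "vert_poly A x = 0"
    using assms poly_roots_finite[of "vert_poly A x"] by (auto simp: poly_vert_poly)
  then show ?thesis
    by (metis poly_vert_poly poly_0)
qed

text \<open>A nonzero \<open>A\<close>, seen as a polynomial in \<open>y\<close> with coefficients
  in \<open>x\<close>, has finitely many constant roots \<open>[:y:]\<close>. Any other
  \<open>y\<close> leaves a nonzero polynomial in \<open>x\<close>, which cannot vanish on the
  infinite set \<open>X\<close>.\<close>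

lemma poly2_eq_0I:
  assumes "infinite X" and "\<And>x. x \<in> X \<Longrightarrow> infinite {y. poly2 A x y = 0}"
  shows "A = 0"
proof (rule ccontr)
  assume "A \<noteq> 0"
  then have "finite {y. poly A [:y:] = 0}"
  proof -
    have "finite {p. poly A p = 0}"
      using \<open>A \<noteq> 0\<close> by (rule poly_roots_finite)
    then have "finite ((\<lambda>y. [:y:]) -` {p. poly A p = 0})"
      by (rule finite_vimageI) (auto simp: inj_def)
    then show ?thesis by (simp add: vimage_def)
  qed
  then obtain y where y: "poly A [:y:] \<noteq> 0"
    using infinite_UNIV_char_0[where 'a=complex] by (metis (mono_tags, lifting) UNIV_I finite_subset mem_Collect_eq subsetI)
  have "X \<subseteq> {x. poly (poly A [:y:]) x = 0}"
    using poly2_vertical[OF assms(2)] by (auto simp: poly2_def)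
  then show False
    using poly_roots_finite[OF y] assms(1) finite_subset by blast
qed

lemma poly2_eqI:
  assumes "\<And>x y. poly2 A x y = poly2 B x y"
  shows "A = B"
  using poly2_eq_0I[of UNIV "A - B"] assms infinite_UNIV_char_0[where 'a=complex] by simp

text \<open>An open set contains a product of two real intervals, and such a grid is large enough to
  determine a polynomial.\<close>

lemma poly2_nonzero_on_open:
  assumes "open D" "z0 \<in> D" "A \<noteq> 0"
  shows "\<exists>z\<in>D. poly2 A (Re z) (Im z) \<noteq> 0"
proof -
  obtain e where e: "e > 0" "ball z0 e \<subseteq> D"
    using assms open_contains_ball by blast
  define I where "I = (\<lambda>a. complex_of_real ` {a<..<a + e / 2})"
  have inf: "infinite (I a)" for a
    unfolding I_def using e(1) by (subst finite_image_iff) (auto simp: inj_on_def)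
  show ?thesis
  proof (rule ccontr)
    assume "\<not> ?thesis"
    then have z: "poly2 A (Re z) (Im z) = 0" if "z \<in> D" for z
      using that by blast
    have "A = 0"
    proof (rule poly2_eq_0I)
      show "infinite (I (Re z0))" by (rule inf)
      fix x assume "x \<in> I (Re z0)"
      then obtain r where r: "x = of_real r" "Re z0 < r" "r < Re z0 + e / 2"
        by (auto simp: I_def)
      have "I (Im z0) \<subseteq> {y. poly2 A x y = 0}"
      proof
        fix y assume "y \<in> I (Im z0)"
        then obtain s where s: "y = of_real s" "Im z0 < s" "s < Im z0 + e / 2"
          by (auto simp: I_def)
        have "cmod (Complex r s - z0) \<le> \<bar>r - Re z0\<bar> + \<bar>s - Im z0\<bar>"
          using cmod_le[of "Complex r s - z0"] by simp
        then have "Complex r s \<in> D"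
          using e(2) r s by (auto simp: subset_iff dist_norm norm_minus_commute)
        with z[OF this] r s show "y \<in> {y. poly2 A x y = 0}" by simp
      qed
      then show "infinite {y. poly2 A x y = 0}"
        using inf infinite_super by blast
    qed
    with \<open>A \<noteq> 0\<close> show False by simp
  qed
qed

lemma degree_monom_minus_const:
  fixes p c :: complex
  assumes "p \<noteq> 0" "n > 0"
  shows "degree (monom p n - [:c:]) = n" "monom p n - [:c:] \<noteq> 0"
proof -
  have "degree (monom p n + - [:c:]) = degree (monom p n)"
    using assms by (intro degree_add_eq_left) (simp add: degree_monom_eq)
  then show "degree (monom p n - [:c:]) = n"
    using assms(1) by (metis degree_monom_eq diff_conv_add_uminus)
  then show "monom p n - [:c:] \<noteq> 0" using assms by auto
qed

section \<open>Total degree and homogeneity on lines through the origin\<close>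

lemma finite_total_degree_set: "finite {i + j | i j. coeff (coeff A j) i \<noteq> 0}"
proof (rule finite_subset)
  show "{i + j | i j. coeff (coeff A j) i \<noteq> 0} \<subseteq>
      (\<Union>j\<le>degree A. (\<lambda>i. i + j) ` {..degree (coeff A j)})"
  proof clarsimp
    fix i j assume "coeff (coeff A j) i \<noteq> 0"
    then have "coeff A j \<noteq> 0" by auto
    then show "\<exists>j'\<in>{..degree A}. i + j \<in> (\<lambda>i. i + j') ` {..degree (coeff A j')}"
      using \<open>coeff (coeff A j) i \<noteq> 0\<close> by (intro bexI[of _ j]) (auto simp: le_degree)
  qed
qed auto

lemma total_degree_attained:
  assumes "total_degree A > 0"
  obtains i j where "coeff (coeff A j) i \<noteq> 0" "i + j = total_degree A"
proof -
  have "total_degree A \<in> insert 0 {i + j | i j. coeff (coeff A j) i \<noteq> 0}"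
    unfolding total_degree_def using finite_total_degree_set by (intro Max_in) auto
  then show thesis using assms that by auto
qed

lemma coeff_line:
  fixes A :: "'a::comm_ring_1 poly poly"
  shows "coeff (poly A [:0, b:]) d = (\<Sum>j\<le>degree A. (if j \<le> d then coeff (coeff A j) (d - j) else 0) * b ^ j)"
proof -
  have "[:0, b:] ^ j = monom (b ^ j) j" for j
    by (induction j) (simp_all add: monom_Suc monom_0 mult_monom smult_monom)
  moreover have "coeff (p * monom c j) d = (if j \<le> d then coeff p (d - j) else 0) * c" for p and c :: 'a and j
    by (subst mult.commute[of p]) (simp add: coeff_monom_mult mult.commute[of c])
  ultimately show ?thesis
    by (simp add: poly_altdef[of A] coeff_sum)
qed

text \<open>The degree drops only along slopes \<open>b\<close> that are roots of a nonzero
  polynomial, the leading form evaluated at \<open>(1, b)\<close>.\<close>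

lemma finite_degree_line_less:
  assumes "total_degree A > 0"
  shows "finite {b. degree (poly A [:0, b:]) < total_degree A}"
proof -
  let ?d = "total_degree A"
  obtain i j where ij: "coeff (coeff A j) i \<noteq> 0" "i + j = ?d"
    using total_degree_attained[OF assms] .
  define T where "T = (\<Sum>j\<le>degree A. monom (if j \<le> ?d then coeff (coeff A j) (?d - j) else 0) j)"
  have "coeff A j \<noteq> 0" using ij by auto
  then have "coeff T j = coeff (coeff A j) i"
    using ij by (auto simp: T_def coeff_sum le_degree coeff_monom simp flip: ij(2))
  then have "T \<noteq> 0" using ij by auto
  then have "finite {b. poly T b = 0}" by (rule poly_roots_finite)
  have T: "poly T b = coeff (poly A [:0, b:]) ?d" for b
    by (simp add: T_def coeff_line poly_sum poly_monom)
  have "{b. degree (poly A [:0, b:]) < ?d} \<subseteq> {b. poly T b = 0}"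
  proof clarify
    fix b assume "degree (poly A [:0, b:]) < ?d"
    then show "poly T b = 0" unfolding T by (rule coeff_eq_0)
  qed
  then show ?thesis
    using \<open>finite {b. poly T b = 0}\<close> by (rule finite_subset)
qed

lemma homogeneous_poly2:
  assumes "homogeneous_of_degree n P"
  shows "poly2 P (t * x) (t * y) = t ^ n * poly2 P x y"
proof -
  have "coeff (coeff P j) i * (t * x) ^ i * (t * y) ^ j
      = t ^ n * (coeff (coeff P j) i * x ^ i * y ^ j)" for i j
  proof (cases "coeff (coeff P j) i = 0")
    case False
    then have "n = i + j" using assms by (auto simp: homogeneous_of_degree_def)
    then show ?thesis by (simp add: power_mult_distrib power_add mult_ac)
  qed simp
  then show ?thesis
    unfolding poly2_eq_sum poly_altdef sum_distrib_left sum_distrib_right by (intro sum.cong refl)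
qed

lemma homogeneous_line:
  assumes "homogeneous_of_degree n P"
  shows "poly P [:0, b:] = monom (poly2 P 1 b) n"
proof (rule poly_ext)
  fix x
  show "poly (poly P [:0, b:]) x = poly (monom (poly2 P 1 b) n) x"
    using homogeneous_poly2[OF assms, of x 1 b] by (simp add: poly_line poly_monom mult.commute)
qed

section \<open>The ideal of a perfect curve without vertical components\<close>

text \<open>Gauss's lemma: contents multiply, so \<open>d\<close> divides the content of the
  cofactor of the primitive \<open>h\<close> and can be cancelled.\<close>

lemma primitive_dvd_smult_cancel:
  fixes h e :: "complex poly poly"
  assumes "content h = 1" "d \<noteq> 0" "h dvd smult d e"
  shows "h dvd e"
proof -
  obtain q where q: "smult d e = h * q" using assms(3) by (auto simp: dvd_def)
  then have "[:d:] dvd h * q" by (intro dvdI[of _ _ e]) simp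
  then have "d dvd content (h * q)"
    by (simp add: const_poly_dvd_iff_dvd_content)
  then have "d dvd content q"
    using assms(1) by (simp add: content_mult)
  then have "[:d:] dvd q"
    by (simp add: const_poly_dvd_iff_dvd_content)
  then obtain q' where "q = smult d q'"
    by (auto simp: dvd_def)
  with q have "smult d e = smult d (h * q')" by simp
  then have "e = h * q'" using assms(2) smult_cancel by blast
  then show ?thesis by simp
qed

text \<open>Unlike \<open>defines_curve\<close>, this admits the zero polynomial, so that the
  polynomials in question form an ideal.\<close>

definition vanishes :: "complex set \<Rightarrow> complex poly poly \<Rightarrow> bool" where
  "vanishes \<Gamma> A \<longleftrightarrow> (\<forall>z\<in>\<Gamma>. poly2 A (Re z) (Im z) = 0)"

text \<open>An element of least degree in \<open>y\<close> divides, by pseudo-division, every element of the ideal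
  up to factors in \<open>\<complex>[x]\<close>. Its primitive part therefore generates the ideal, provided it still
  vanishes on \<open>\<Gamma>\<close>; it can only fail to do so on finitely many vertical lines.\<close>

lemma vanishes_generator:
  assumes perfect: "\<And>z. z \<in> \<Gamma> \<Longrightarrow> z islimpt \<Gamma>"
    and Q: "Q \<noteq> 0" "vanishes \<Gamma> Q"
    and vert: "\<And>a. finite {z \<in> \<Gamma>. Re z = a}"
  obtains h where "h \<noteq> 0" "vanishes \<Gamma> h" "\<And>A. vanishes \<Gamma> A \<Longrightarrow> h dvd A"
proof -
  obtain h where h: "h \<noteq> 0" "vanishes \<Gamma> h"
    and min: "\<And>A. A \<noteq> 0 \<Longrightarrow> vanishes \<Gamma> A \<Longrightarrow> degree h \<le> degree A"
    using ex_has_least_nat[of "\<lambda>A. A \<noteq> 0 \<and> vanishes \<Gamma> A" Q degree] Q by blast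
  define h' where "h' = primitive_part h"
  have h': "smult (content h) h' = h" "content h \<noteq> 0" "content h' = 1" "h' \<noteq> 0"
    using h(1) by (auto simp: h'_def)
  show thesis
  proof
    show "h' \<noteq> 0" by (rule h')
    show "h' dvd A" if "vanishes \<Gamma> A" for A
    proof -
      obtain a q where aq: "a \<noteq> 0" "smult a A = h * q + pseudo_mod A h"
        using pseudo_mod(1)[OF h(1), of A] by blast
      then have "pseudo_mod A h = smult a A - h * q" by simp
      then have "vanishes \<Gamma> (pseudo_mod A h)"
        using that h(2) by (auto simp: vanishes_def)
      \<comment> \<open>A nonzero remainder would be an element of the ideal with smaller degree in
        \<open>y\<close> than \<open>h\<close>.\<close>
      then have "pseudo_mod A h = 0"
        using pseudo_mod(2)[OF h(1), of A] min[of "pseudo_mod A h"] by linarith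
      then have "smult a A = h' * smult (content h) q"
        using aq h'(1) by (metis add.right_neutral mult_smult_left mult_smult_right)
      then show ?thesis
        using primitive_dvd_smult_cancel h'(3) aq(1) by (metis dvd_triv_left)
    qed
    have "\<Gamma> \<inter> {z. poly (content h) (of_real (Re z)) = 0} =
        (\<Union>a \<in> of_real -` {x. poly (content h) x = 0}. {z \<in> \<Gamma>. Re z = a})"
      by auto
    moreover have "finite (of_real -` {x. poly (content h) x = 0} :: real set)"
      using poly_roots_finite[OF h'(2)] by (rule finite_vimageI) (auto simp: inj_def)
    ultimately have fin: "finite (\<Gamma> \<inter> {z. poly (content h) (of_real (Re z)) = 0})"
      using vert by simp
    let ?S = "\<Gamma> - \<Gamma> \<inter> {z. poly (content h) (of_real (Re z)) = 0}"
    have zero: "poly2 h' (Re z) (Im z) = 0" if "z \<in> ?S" for z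
    proof -
      have "poly2 (smult (content h) h') (Re z) (Im z) = 0"
        using that h(2) h'(1) by (simp add: vanishes_def)
      then show ?thesis using that by simp
    qed
    have "poly2 h' (Re z) (Im z) = 0" if "z \<in> \<Gamma>" for z
    proof -
      \<comment> \<open>In a perfect set a point stays a limit point after finitely many points are
        removed, so continuity restores the lost zeros.\<close>
      have "z islimpt (\<Gamma> \<inter> {z. poly (content h) (of_real (Re z)) = 0}) \<union> ?S"
        by (rule islimpt_subset[OF perfect[OF that]]) auto
      then have "z islimpt ?S"
        using islimpt_Un_finite[OF fin] by blast
      then have "z \<in> closure ?S" by (simp add: closure_def)
      then show ?thesis
        by (rule continuous_constant_on_closure[rotated -1])
          (use zero in \<open>auto intro!: continuous_intros\<close>)
    qed
    then show "vanishes \<Gamma> h'" by (simp add: vanishes_def)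
  qed
qed

text \<open>Write \<open>P - c0 = h w\<close>. On almost every line through the origin
  \<open>P - c0\<close> has degree \<open>n\<close> and \<open>h\<close> has degree at least
  \<open>n\<close>, so \<open>w\<close> is constant there. Hence \<open>w\<close> is a constant, and
  it is nonzero because \<open>P\<close> is not constant.\<close>

lemma dvd_of_minimal_total_degree:
  assumes hom: "homogeneous_of_degree n P" and n: "n > 0"
    and dvd: "h dvd P - [:[:c0:]:]" and deg: "n \<le> total_degree h"
  shows "P - [:[:c0:]:] dvd h"
proof -
  obtain w where w: "P - [:[:c0:]:] = h * w" using dvd by (auto simp: dvd_def)
  have "P \<noteq> 0" using hom by (simp add: homogeneous_of_degree_def)
  define p where "p = vert_poly P 1"
  have "p \<noteq> 0"
  proof
    assume "p = 0"
    then have p0: "poly2 P 1 y = 0" for y by (metis p_def poly_vert_poly poly_0)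
    have "P = 0"
    proof (rule poly2_eq_0I[of "- {0}"])
      fix x :: complex assume x: "x \<in> - {0}"
      have "poly2 P x y = 0" for y
        using homogeneous_poly2[OF hom, of x 1 "y / x"] x p0 by simp
      then show "infinite {y. poly2 P x y = 0}"
        using infinite_UNIV_char_0[where 'a=complex] by simp
    qed (simp add: infinite_UNIV_char_0 Compl_eq_Diff_UNIV)
    with \<open>P \<noteq> 0\<close> show False by simp
  qed
  \<comment> \<open>The slopes along which \<open>P - c0\<close> or \<open>h\<close> may lose
    degree.\<close>
  define B where "B = {b. poly p b = 0} \<union> {b. degree (poly h [:0, b:]) < total_degree h}"
  have B: "finite B"
    unfolding B_def using poly_roots_finite[OF \<open>p \<noteq> 0\<close>] finite_degree_line_less[of h] n deg by simp
  \<comment> \<open>All the lines meet at the origin, so the constants found on them coincide with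
    this value.\<close>
  define w0 where "w0 = poly2 w 0 0"
  have line: "poly2 w x (b * x) = w0" if "b \<notin> B" for b x
  proof -
    have "poly2 P 1 b \<noteq> 0" using that by (simp add: B_def p_def poly_vert_poly)
    moreover have eq: "monom (poly2 P 1 b) n - [:c0:] = poly h [:0, b:] * poly w [:0, b:]"
      using arg_cong[OF w, of "\<lambda>A. poly A [:0, b:]"] by (simp add: homogeneous_line[OF hom])
    ultimately have dn: "degree (monom (poly2 P 1 b) n - [:c0:]) = n" "monom (poly2 P 1 b) n - [:c0:] \<noteq> 0"
      using degree_monom_minus_const[of "poly2 P 1 b" n c0] n by auto
    with eq dn have "degree (poly h [:0, b:]) + degree (poly w [:0, b:]) = n"
      by (metis degree_mult_eq mult_eq_0_iff)
    then have "degree (poly w [:0, b:]) = 0"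
      using that deg by (auto simp: B_def)
    then obtain c where "poly w [:0, b:] = [:c:]" by (metis degree_eq_zeroE)
    then have "poly2 w x (b * x) = c" for x by (simp flip: poly_line)
    from this[of x] this[of 0] show ?thesis by (simp add: w0_def)
  qed
  have "w - [:[:w0:]:] = 0"
  proof (rule poly2_eq_0I[of "- {0}"])
    fix x :: complex assume x: "x \<in> - {0}"
    have "(\<lambda>b. b * x) ` (- B) \<subseteq> {y. poly2 (w - [:[:w0:]:]) x y = 0}"
      using line by auto
    moreover have "infinite ((\<lambda>b. b * x) ` (- B))"
      using x B by (subst finite_image_iff) (auto simp: inj_on_def infinite_UNIV_char_0 Compl_eq_Diff_UNIV)
    ultimately show "infinite {y. poly2 (w - [:[:w0:]:]) x y = 0}"
      using infinite_super by blast
  qed (simp add: infinite_UNIV_char_0 Compl_eq_Diff_UNIV)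
  then have w0: "w = [:[:w0:]:]" by simp
  have "w0 \<noteq> 0"
  proof
    assume "w0 = 0"
    then have "P = [:[:c0:]:]" using w w0 by simp
    with hom n show False
      by (auto simp: homogeneous_of_degree_def coeff_pCons split: nat.splits if_splits)
  qed
  then have "h = (P - [:[:c0:]:]) * [:[:1 / w0:]:]"
    unfolding w w0 by (intro poly2_eqI) simp
  then show ?thesis by (rule dvdI)
qed

section \<open>Restriction to lines through the origin\<close>

text \<open>The degree of \<open>r\<close> is at most \<open>k < n\<close>, so the coefficients of
  \<open>g\<close> in degrees \<open>n + k\<close> and \<open>k\<close> are \<open>p\<close> and
  \<open>- c0\<close> times the same coefficient of \<open>r\<close>, which is eliminated.\<close>

lemma coeff_relation:
  fixes p c0 :: complex and r :: "complex poly"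
  assumes eq: "(monom p n - [:c0:]) * r = g" and p: "p \<noteq> 0"
    and deg: "degree g \<le> n + k" and k: "k < n"
  shows "p * coeff g k = - c0 * coeff g (n + k)"
proof -
  have dn: "degree (monom p n - [:c0:]) = n" "monom p n - [:c0:] \<noteq> 0"
    using degree_monom_minus_const[OF p] k by auto
  have "degree r \<le> k"
  proof (cases "r = 0")
    case False
    have "degree g = n + degree r"
      using degree_mult_eq[of "monom p n - [:c0:]" r] False dn eq by simp
    then show ?thesis using deg by simp
  qed simp
  then have "coeff r (n + k) = 0" using k by (intro coeff_eq_0) simp
  moreover have c: "coeff g m = (if n \<le> m then p * coeff r (m - n) else 0) - c0 * coeff r m" for m
    by (simp flip: eq add: left_diff_distrib coeff_monom_mult)
  ultimately show ?thesis using k by (simp add: c)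
qed

text \<open>Restriction to \<open>y = b x\<close> with \<open>P(1, b) \<noteq> 0\<close> reduces
  this to \<open>coeff_relation\<close>. Both sides are homogeneous of degree \<open>n + k\<close>,
  which spreads the identity from \<open>(1, b)\<close> over the line.\<close>

lemma leading_part_identity:
  fixes G1 G2 :: "complex poly" and \<alpha>1 \<alpha>2 :: complex
  assumes hom: "homogeneous_of_degree n P"
    and dvd: "P - [:[:c0:]:] dvd G"
    and G: "\<And>x y. poly2 G x y = poly G1 (x + \<alpha>1 * y) - poly G2 (x + \<alpha>2 * y)"
    and deg: "degree G1 \<le> n + k" "degree G2 \<le> n + k" and k: "k < n"
  shows "c0 * (coeff G1 (n + k) * (x + \<alpha>1 * y) ^ (n + k) - coeff G2 (n + k) * (x + \<alpha>2 * y) ^ (n + k))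
      = - poly2 P x y * (coeff G1 k * (x + \<alpha>1 * y) ^ k - coeff G2 k * (x + \<alpha>2 * y) ^ k)"
proof -
  obtain R where R: "G = (P - [:[:c0:]:]) * R" using dvd by (auto simp: dvd_def)
  have line: "c0 * (coeff G1 (n + k) * (1 + \<alpha>1 * b) ^ (n + k) - coeff G2 (n + k) * (1 + \<alpha>2 * b) ^ (n + k))
      = - poly2 P 1 b * (coeff G1 k * (1 + \<alpha>1 * b) ^ k - coeff G2 k * (1 + \<alpha>2 * b) ^ k)"
    if "poly2 P 1 b \<noteq> 0" for b
  proof -
    define g where "g = pcompose G1 [:0, 1 + \<alpha>1 * b:] - pcompose G2 [:0, 1 + \<alpha>2 * b:]"
    have "poly G [:0, b:] = g"
      by (rule poly_ext) (simp add: poly_line G g_def poly_pcompose algebra_simps)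
    then have "(monom (poly2 P 1 b) n - [:c0:]) * poly R [:0, b:] = g"
      using R by (simp add: homogeneous_line[OF hom])
    moreover have "degree g \<le> n + k"
      unfolding g_def
      by (intro degree_diff_le order.trans[OF degree_pcompose_le]) (use deg in auto)
    ultimately have "poly2 P 1 b * coeff g k = - c0 * coeff g (n + k)"
      using coeff_relation that k by blast
    then show ?thesis
      by (simp add: g_def coeff_pcompose_linear algebra_simps)
  qed
  define X where "X = ([:[:0, 1:]:] :: complex poly poly)"
  define lin where "lin = (\<lambda>\<alpha>. [:[:0, 1:], [:\<alpha>:]:] :: complex poly poly)"
  have X: "poly2 X x y = x" and lin: "poly2 (lin \<alpha>) x y = x + \<alpha> * y" for x y \<alpha>
    by (simp_all add: X_def lin_def poly2_def algebra_simps)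
  define W where "W = [:[:c0:]:] * ([:[:coeff G1 (n + k):]:] * lin \<alpha>1 ^ (n + k) - [:[:coeff G2 (n + k):]:] * lin \<alpha>2 ^ (n + k))
      + P * ([:[:coeff G1 k:]:] * lin \<alpha>1 ^ k - [:[:coeff G2 k:]:] * lin \<alpha>2 ^ k)"
  have W: "poly2 W x y = c0 * (coeff G1 (n + k) * (x + \<alpha>1 * y) ^ (n + k) - coeff G2 (n + k) * (x + \<alpha>2 * y) ^ (n + k))
      + poly2 P x y * (coeff G1 k * (x + \<alpha>1 * y) ^ k - coeff G2 k * (x + \<alpha>2 * y) ^ k)" for x y
    by (simp add: W_def lin)
  \<comment> \<open>The factors \<open>X\<close> and \<open>P\<close> vanish at the points not
    reached by the lines; afterwards they cancel in the integral domain.\<close>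
  have "W * (X * P) = 0"
  proof (rule poly2_eqI)
    fix x y
    have "poly2 W x y = 0" if "x \<noteq> 0" "poly2 P x y \<noteq> 0"
    proof -
      define b where "b = y / x"
      have xb: "x + \<alpha> * y = x * (1 + \<alpha> * b)" for \<alpha> using that by (simp add: b_def field_simps)
      have Pb: "poly2 P x y = x ^ n * poly2 P 1 b"
        using homogeneous_poly2[OF hom, of x 1 b] that by (simp add: b_def)
      then have "poly2 W 1 b = 0"
        using line[of b] that by (simp add: W)
      moreover have "poly2 W x y = x ^ (n + k) * poly2 W 1 b"
        unfolding W xb Pb power_mult_distrib power_add by (simp add: algebra_simps)
      ultimately show ?thesis by simp
    qed
    then show "poly2 (W * (X * P)) x y = poly2 0 x y" by (auto simp: X)
  qed
  moreover have "P \<noteq> 0" "X \<noteq> 0" using hom by (simp_all add: homogeneous_of_degree_def X_def)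
  ultimately have "W = 0" by simp
  then show ?thesis using W[of x y] by (simp add: eq_neg_iff_add_eq_0)
qed

text \<open>If \<open>A\<close> and \<open>B\<close> were both nonzero, every solution of \<open>a u\<^sup>k = b v\<^sup>k\<close> would
  solve \<open>A u\<^sup>n\<^sup>+\<^sup>k = B v\<^sup>n\<^sup>+\<^sup>k\<close>; multiplying \<open>u\<close> by a primitive
  \<open>k\<close>-th root of unity would then give \<open>k dvd n\<close>.\<close>

lemma cofactor_of_binomial:
  fixes f :: "complex \<Rightarrow> complex \<Rightarrow> complex"
  assumes eq: "\<And>u v. c * (A * u ^ (n + k) - B * v ^ (n + k)) = - f u v * (a * u ^ k - b * v ^ k)"
    and c: "c \<noteq> 0" and AB: "A \<noteq> 0 \<or> B \<noteq> 0" and k: "k \<ge> 1" "\<not> k dvd n"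
  shows "\<exists>C. (\<forall>u v. u \<noteq> 0 \<longrightarrow> f u v = C * u ^ n) \<or> (\<forall>u v. v \<noteq> 0 \<longrightarrow> f u v = C * v ^ n)"
proof -
  \<comment> \<open>At \<open>v = 0\<close> only one term remains in each bracket; the next line is
    the symmetric case.\<close>
  have aA: "a \<noteq> 0" if "A \<noteq> 0" using eq[of 1 0] that c k by (auto simp: power_0_left)
  have bB: "b \<noteq> 0" if "B \<noteq> 0" using eq[of 0 1] that c k by (auto simp: power_0_left)
  have root: "A * s ^ (n + k) = B" if "a * s ^ k = b" for s
  proof -
    have "c * (A * s ^ (n + k) - B) = 0" using eq[of s 1] that by simp
    then show ?thesis using c by simp
  qed
  have ex: "\<exists>s. a * s ^ k = b" if "a \<noteq> 0"
  proof -
    obtain s where "b / a = s ^ k"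
      by (rule exists_complex_root[of k "b / a"]) (use k in simp)
    then have "s ^ k = b / a" ..
    then show ?thesis using that by (intro exI[of _ s]) simp
  qed
  have not_both: "A = 0 \<or> B = 0"
  proof (rule ccontr)
    assume *: "\<not> (A = 0 \<or> B = 0)"
    obtain s where s: "a * s ^ k = b" using ex aA * by blast
    define \<omega> where "\<omega> = exp (2 * of_real pi * \<i> * of_nat 1 / of_nat k)"
    have \<omega>: "\<omega> ^ j = 1 \<longleftrightarrow> k dvd j" for j
    proof -
      have "\<omega> ^ j = exp (2 * of_real pi * \<i> * of_nat j / of_nat k)"
        unfolding \<omega>_def exp_of_nat_mult[symmetric] by (simp add: algebra_simps)
      then show ?thesis using complex_root_unity_eq_1[OF k(1), of j] by simp
    qed
    have "A * (\<omega> * s) ^ (n + k) = A * s ^ (n + k)"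
      using root[OF s] root[of "\<omega> * s"] s \<omega>[of k] by (simp add: power_mult_distrib)
    moreover have "s ^ (n + k) \<noteq> 0" using root[OF s] * by auto
    ultimately have "\<omega> ^ (n + k) = 1" using * by (auto simp: power_mult_distrib)
    then show False using \<omega> k by simp
  qed
  show ?thesis
  proof (cases "A = 0")
    case False
    then have "B = 0" using not_both by simp
    \<comment> \<open>A root of \<open>a * s ^ k = b\<close> also satisfies
      \<open>A * s ^ (n + k) = 0\<close>, which forces \<open>s = 0\<close>.\<close>
    have "b = 0"
    proof -
      obtain s where s: "a * s ^ k = b" using ex aA False by blast
      then have "s ^ (n + k) = 0" using root[OF s] \<open>B = 0\<close> False by simp
      then show "b = 0" using s k by (simp add: power_0_left)
    qed
    \<comment> \<open>Division by \<open>u ^ k\<close> is the reason for the restriction to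
      \<open>u \<noteq> 0\<close>.\<close>
    have "f u v = (- c * A / a) * u ^ n" if "u \<noteq> 0" for u v
    proof -
      have "u ^ k * (a * f u v) = u ^ k * (- c * A * u ^ n)"
        using eq[of u v] \<open>B = 0\<close> \<open>b = 0\<close> by (simp add: power_add algebra_simps)
      then have "a * f u v = - c * A * u ^ n" using that unfolding mult_cancel_left by simp
      then show ?thesis using aA[OF False] by (simp add: field_simps)
    qed
    then show ?thesis by blast
  next
    case True
    then have "B \<noteq> 0" using AB by simp
    have "a = 0"
    proof (rule ccontr)
      assume "a \<noteq> 0"
      then obtain s where "a * s ^ k = b" using ex by blast
      with root[OF this] True \<open>B \<noteq> 0\<close> show False by simp
    qed
    have "f u v = (- c * B / b) * v ^ n" if "v \<noteq> 0" for u v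
    proof -
      have "v ^ k * (b * f u v) = v ^ k * (- c * B * v ^ n)"
        using eq[of u v] True \<open>a = 0\<close> by (simp add: power_add algebra_simps)
      then have "b * f u v = - c * B * v ^ n" using that unfolding mult_cancel_left by simp
      then show ?thesis using bB[OF \<open>B \<noteq> 0\<close>] by (simp add: field_simps)
    qed
    then show ?thesis by blast
  qed
qed

section \<open>Boundary values of polynomials\<close>

lemma access_path_tendsto:
  assumes "access_path D \<zeta> \<gamma>"
  shows "((\<lambda>t. poly F (\<gamma> t)) \<longlongrightarrow> poly F \<zeta>) (at_left 1)"
proof -
  have "continuous_on {0..1} \<gamma>" "\<gamma> 1 = \<zeta>"
    using assms by (auto simp: access_path_def path_def pathfinish_def)
  then have "(\<gamma> \<longlongrightarrow> \<zeta>) (at 1 within {0..1})"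
    by (metis atLeastAtMost_iff continuous_on_def order_refl zero_le_one)
  then have "(\<gamma> \<longlongrightarrow> \<zeta>) (at_left 1)"
    by (simp add: at_within_Icc_at_left)
  then show ?thesis by (intro tendsto_intros)
qed

text \<open>Continuity gives the limit along every access path; the existence of one path makes the
  described value unique.\<close>

lemma boundary_value_poly:
  assumes "access_path D \<zeta> \<gamma>"
  shows "boundary_value D (poly F) \<zeta> = poly F \<zeta>"
  unfolding boundary_value_def
proof (rule the_equality)
  fix l assume "\<forall>\<gamma>. access_path D \<zeta> \<gamma> \<longrightarrow> ((\<lambda>t. poly F (\<gamma> t)) \<longlongrightarrow> l) (at_left 1)"
  then show "l = poly F \<zeta>"
    using access_path_tendsto[OF assms, of F] assms tendsto_unique[OF trivial_limit_at_left_real] by blast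
qed (use access_path_tendsto in blast)

text \<open>Every nonempty relatively open piece of the frontier contains the endpoint of an arc
  that otherwise runs inside \<open>D\<close>.\<close>

lemma frontier_subset_closure_accessible:
  assumes "open D"
  shows "frontier D \<subseteq> closure (accessible_points D)"
proof
  fix \<zeta> assume z: "\<zeta> \<in> frontier D"
  show "\<zeta> \<in> closure (accessible_points D)"
    unfolding closure_approachable
  proof (intro allI impI)
    fix e :: real assume e: "e > 0"
    have "openin (top_of_set (frontier D)) (frontier D \<inter> ball \<zeta> e)" by auto
    moreover have "frontier D \<inter> ball \<zeta> e \<noteq> {}" using z e by auto
    ultimately obtain g where g: "arc g" "g ` {0..<1} \<subseteq> D" "pathfinish g \<in> frontier D \<inter> ball \<zeta> e"
      using dense_accessible_frontier_points[OF assms] by metis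
    then have "pathfinish g \<in> accessible_points D"
      using arc_imp_path[OF g(1)] by (auto simp: accessible_points_def access_path_def)
    with g show "\<exists>y\<in>accessible_points D. dist y \<zeta> < e"
      by (auto simp: dist_commute intro!: bexI[of _ "pathfinish g"])
  qed
qed

lemma T_beta_eq: "T_beta \<beta> z = of_real (Re z) + \<i> / of_real \<beta> * of_real (Im z)"
  by (simp add: T_beta_def complex_eq_iff Re_divide_of_real Im_divide_of_real)

lemma continuous_on_T_beta: "continuous_on S (T_beta \<beta>)"
  unfolding T_beta_eq by (intro continuous_intros)

lemma inj_T_beta: "\<beta> \<noteq> 0 \<Longrightarrow> inj (T_beta \<beta>)"
  by (auto simp: inj_def T_beta_def complex_eq_iff)

text \<open>\<open>T_beta\<close> carries access paths to access paths, so the equation holds at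
  accessible points; these are dense and both sides are continuous.\<close>

lemma admissible_pair_frontier:
  assumes "open D" "admissible_pair \<beta> D (poly F1) (poly F2)" "\<zeta> \<in> frontier D"
  shows "poly F1 \<zeta> = poly F2 (T_beta \<beta> \<zeta>)"
proof -
  have acc: "poly F1 \<zeta> - poly F2 (T_beta \<beta> \<zeta>) = 0" if acc: "\<zeta> \<in> accessible_points D" for \<zeta>
  proof -
    obtain \<gamma> where g: "access_path D \<zeta> \<gamma>" using acc by (auto simp: accessible_points_def)
    then have "access_path (T_beta \<beta> ` D) (T_beta \<beta> \<zeta>) (T_beta \<beta> \<circ> \<gamma>)"
      by (auto simp: access_path_def pathfinish_def path_continuous_image continuous_on_T_beta)
    moreover have "boundary_value D (poly F1) \<zeta> = boundary_value (T_beta \<beta> ` D) (poly F2) (T_beta \<beta> \<zeta>)"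
      using assms(2) acc by (simp add: admissible_pair_def)
    ultimately show ?thesis
      using boundary_value_poly g by simp
  qed
  have "\<zeta> \<in> closure (accessible_points D)"
    using frontier_subset_closure_accessible assms by blast
  then have "poly F1 \<zeta> - poly F2 (T_beta \<beta> \<zeta>) = 0"
    by (rule continuous_constant_on_closure[rotated -1])
      (use acc in \<open>auto intro!: continuous_intros continuous_on_T_beta\<close>)
  then show ?thesis by simp
qed

section \<open>Conclusion\<close>

text \<open>A ray is connected, starts in \<open>D\<close> and leaves every bounded set.\<close>

lemma ray_meets_frontier:
  fixes D :: "complex set"
  assumes "bounded D" "z0 \<in> D" "w \<noteq> 0"
  shows "\<exists>t\<ge>0. z0 + of_real t * w \<in> frontier D"
proof -
  let ?S = "(\<lambda>t. z0 + of_real t * w) ` {0..}"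
  obtain M where M: "\<And>z. z \<in> D \<Longrightarrow> cmod z \<le> M" using assms(1) by (auto simp: bounded_iff)
  \<comment> \<open>This makes \<open>cmod (t w)\<close> larger than \<open>M + cmod z0\<close>, its
    bound if the point were in \<open>D\<close>.\<close>
  define t where "t = (\<bar>M\<bar> + cmod z0 + 1) / cmod w"
  have "t \<ge> 0" by (simp add: t_def)
  moreover have "z0 + of_real t * w \<notin> D"
  proof
    assume "z0 + of_real t * w \<in> D"
    then have "cmod (z0 + of_real t * w) \<le> M" by (rule M)
    moreover have "cmod (of_real t * w) \<le> cmod (z0 + of_real t * w) + cmod z0"
      using norm_triangle_ineq4[of "z0 + of_real t * w" z0] by simp
    moreover have "cmod (of_real t * w) = \<bar>M\<bar> + cmod z0 + 1"
      using \<open>t \<ge> 0\<close> assms(3) unfolding norm_mult norm_of_real by (simp add: t_def)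
    ultimately show False by linarith
  qed
  ultimately have "?S - D \<noteq> {}" by auto
  moreover have "?S \<inter> D \<noteq> {}" using assms(2) by (force intro: image_eqI[of _ _ 0])
  moreover have "connected ?S"
    by (intro connected_continuous_image continuous_intros) auto
  ultimately show ?thesis
    using connected_Int_frontier[of ?S D] by auto
qed

text \<open>The polynomial \<open>C w ^ n - c0\<close> is nonzero even for \<open>C = 0\<close>. It
  is applied with \<open>\<tau>\<close> the identity and \<open>T_beta\<close>.\<close>

lemma finite_power_level:
  assumes "n > 0" "c0 \<noteq> 0" "inj \<tau>"
  shows "finite {z. C * \<tau> z ^ n = (c0 :: complex)}"
proof -
  have "monom C n - [:c0:] \<noteq> 0"
    using degree_monom_minus_const(2)[of C n c0] assms by (cases "C = 0") auto
  then have "finite (\<tau> -` {z. poly (monom C n - [:c0:]) z = 0})"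
    using assms(3) poly_roots_finite finite_vimageI by blast
  then show ?thesis by (simp add: poly_monom vimage_def)
qed

theorem theorem2:
  fixes \<beta> :: real and n k :: nat
    and D \<Gamma> :: "complex set"
    and P :: "complex poly poly" and c0 :: complex
    and F1 F2 :: "complex poly"
  assumes "0 < \<beta>" and "\<beta> < 1"
    and "n > 2" and "1 \<le> k" and "k \<le> n" and "\<not> k dvd n"
    and "algebraic_boundary_domain D" and "\<Gamma> = frontier D" and "curve_order \<Gamma> = n"
    and "homogeneous_of_degree n P" and "defines_curve (P - [:[:c0:]:]) \<Gamma>"
    and "L_special \<beta> D"
    and "admissible_pair \<beta> D (poly F1) (poly F2)"
  shows "max (degree F1) (degree F2) \<noteq> n + k"
proof
  assume deg: "max (degree F1) (degree F2) = n + k"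
  note hom = \<open>homogeneous_of_degree n P\<close>
  let ?Q = "P - [:[:c0:]:]"
  have D: "open D" "connected D" "D \<noteq> {}" "bounded D"
    using \<open>L_special \<beta> D\<close> by (auto simp: L_special_def caratheodory_domain_def)
  have "k < n" using \<open>k \<le> n\<close> \<open>\<not> k dvd n\<close> by (cases "k = n") auto
  have Q: "?Q \<noteq> 0" "vanishes \<Gamma> ?Q" and Q0: "\<And>z. z \<in> \<Gamma> \<Longrightarrow> poly2 P (Re z) (Im z) = c0"
    using \<open>defines_curve ?Q \<Gamma>\<close> by (auto simp: defines_curve_def vanishes_def eval_xy_conv_poly2 subset_iff)
  have "P \<noteq> 0" using hom by (simp add: homogeneous_of_degree_def)

  \<comment> \<open>Topology of the boundary curve and nondegeneracy of its equation\<close>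
  have "connected \<Gamma> \<and> (\<forall>z. \<Gamma> \<noteq> {z})"
  proof -
    obtain \<gamma> where g: "simple_path \<gamma>" "pathfinish \<gamma> = pathstart \<gamma>" "D = inside (path_image \<gamma>)"
      using \<open>algebraic_boundary_domain D\<close>
      unfolding algebraic_boundary_domain_def algebraic_jordan_curve_def jordan_curve_def by blast
    then have \<Gamma>: "\<Gamma> = path_image \<gamma>"
      using Jordan_inside_outside \<open>\<Gamma> = frontier D\<close> by blast
    then have "connected \<Gamma>"
      using g simple_path_imp_path connected_path_image by blast
    moreover have "\<Gamma> \<noteq> {z}" for z
      using nonempty_simple_path_endless[OF g(1)] \<Gamma> pathstart_in_path_image[of \<gamma>] by auto
    ultimately show ?thesis by blast
  qed
  then have perfect: "z islimpt \<Gamma>" if "z \<in> \<Gamma>" for z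
    using that connected_imp_perfect[of \<Gamma>] by blast
  have "\<Gamma> \<noteq> {}"
    using ray_meets_frontier[OF \<open>bounded D\<close>, of _ 1] \<open>D \<noteq> {}\<close> \<open>\<Gamma> = frontier D\<close> by fastforce
  then have inf: "infinite \<Gamma>" using perfect islimpt_finite by blast

  have P0: "poly2 P 0 0 = 0"
    using homogeneous_poly2[OF hom, of 0 0 0] \<open>n > 2\<close> by (simp add: power_0_left)
  \<comment> \<open>If \<open>c0 = 0\<close>, then \<open>\<Gamma>\<close> lies in a cone and a generic radial ray escapes from \<open>D\<close>.\<close>
  have "c0 \<noteq> 0"
  proof
    assume "c0 = 0"
    obtain z where z: "z \<in> D" "poly2 P (Re z) (Im z) \<noteq> 0"
      using poly2_nonzero_on_open[OF \<open>open D\<close> _ \<open>P \<noteq> 0\<close>] \<open>D \<noteq> {}\<close> by blast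
    have "z \<noteq> 0"
      using z(2) P0 by auto
    then obtain t where t: "t \<ge> 0" "z + of_real t * z \<in> \<Gamma>"
      using ray_meets_frontier[OF \<open>bounded D\<close> z(1)] \<open>\<Gamma> = frontier D\<close> by blast
    have "poly2 P (Re (z + of_real t * z)) (Im (z + of_real t * z)) = of_real (1 + t) ^ n * poly2 P (Re z) (Im z)"
      using homogeneous_poly2[OF hom, of "of_real (1 + t)" "Re z" "Im z"] by (simp add: algebra_simps)
    then have "of_real (1 + t) ^ n * poly2 P (Re z) (Im z) = 0"
      using Q0[OF t(2)] \<open>c0 = 0\<close> by simp
    moreover have "complex_of_real (1 + t) \<noteq> 0"
      unfolding of_real_eq_0_iff using t(1) by simp
    ultimately show False using z(2) by simp
  qed

  \<comment> \<open>If \<open>Q\<close> has a vertical component, then \<open>P = C x\<^sup>n\<close> and a generic vertical ray escapes from \<open>D\<close>.\<close>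
  have vert: "finite {z \<in> \<Gamma>. Re z = a}" for a
  proof (rule ccontr)
    assume "infinite {z \<in> \<Gamma>. Re z = a}"
    moreover have "inj_on (\<lambda>z. of_real (Im z)) {z \<in> \<Gamma>. Re z = a}"
      by (auto simp: inj_on_def complex_eq_iff)
    ultimately have "infinite ((\<lambda>z. complex_of_real (Im z)) ` {z \<in> \<Gamma>. Re z = a})"
      using finite_imageD by blast
    moreover have "(\<lambda>z. complex_of_real (Im z)) ` {z \<in> \<Gamma>. Re z = a} \<subseteq> {y. poly2 ?Q a y = 0}"
      using Q0 by auto
    ultimately have "infinite {y. poly2 ?Q a y = 0}"
      using infinite_super by blast
    then have Pa: "poly2 P a y = c0" for y
      using poly2_vertical[of ?Q a y] by simp
    have "a \<noteq> 0"
      using Pa[of 0] P0 \<open>c0 \<noteq> 0\<close> by auto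
    \<comment> \<open>Scaling by \<open>x / a\<close> carries the line with abscissa
      \<open>a\<close>, where \<open>P = c0\<close>, to the line with abscissa
      \<open>x\<close>.\<close>
    have Px: "poly2 P x y = (x / a) ^ n * c0" if "x \<noteq> 0" for x y
      using homogeneous_poly2[OF hom, of "x / a" a "y * a / x"] that \<open>a \<noteq> 0\<close> Pa by simp
    \<comment> \<open>The extra factor \<open>x\<close> yields a point of \<open>D\<close> off the
      axis \<open>x = 0\<close> as well as off the zeros of \<open>P - c0\<close>.\<close>
    have "?Q * [:[:0, 1:]:] \<noteq> 0" using Q(1) by (simp del: mult_pCons_right)
    then obtain z where z: "z \<in> D" "poly2 (?Q * [:[:0, 1:]:]) (Re z) (Im z) \<noteq> 0"
      using poly2_nonzero_on_open[OF \<open>open D\<close>] \<open>D \<noteq> {}\<close> by blast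
    have "poly2 [:[:0, 1:]:] x y = x" for x y by (simp add: poly2_def)
    then have z': "Re z \<noteq> 0" "poly2 P (Re z) (Im z) \<noteq> c0"
      using z(2) by (auto simp del: mult_pCons_right)
    obtain t where t: "z + of_real t * \<i> \<in> \<Gamma>"
      using ray_meets_frontier[OF \<open>bounded D\<close> z(1), of \<i>] \<open>\<Gamma> = frontier D\<close> by auto
    from Q0[OF t] z' Px show False by simp
  qed

  \<comment> \<open>Divisibility of the boundary relation by \<open>P - c0\<close>\<close>
  define lin where "lin = (\<lambda>\<alpha>. [:[:0, 1:], [:\<alpha>:]:] :: complex poly poly)"
  have lin: "poly2 (lin \<alpha>) x y = x + \<alpha> * y" for x y \<alpha>
    by (simp add: lin_def poly2_def algebra_simps)
  define \<beta>' where "\<beta>' = \<i> / of_real \<beta>"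
  define G where "G = (\<Sum>i\<le>degree F1. [:[:coeff F1 i:]:] * lin \<i> ^ i)
      - (\<Sum>i\<le>degree F2. [:[:coeff F2 i:]:] * lin \<beta>' ^ i)"
  have G: "poly2 G x y = poly F1 (x + \<i> * y) - poly F2 (x + \<beta>' * y)" for x y
    by (simp add: G_def lin poly_altdef del: mult_pCons_left)
  have T: "T_beta \<beta> z = Re z + \<beta>' * Im z" for z
    by (simp add: T_beta_eq \<beta>'_def)
  have "vanishes \<Gamma> G"
    using admissible_pair_frontier[OF \<open>open D\<close> assms(13)] \<open>\<Gamma> = frontier D\<close>
    by (simp add: vanishes_def G T flip: complex_eq)
  obtain h where h: "h \<noteq> 0" "vanishes \<Gamma> h" "\<And>A. vanishes \<Gamma> A \<Longrightarrow> h dvd A"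
    using vanishes_generator[OF perfect Q vert] by blast
  have "defines_curve h \<Gamma>"
    using h by (auto simp: defines_curve_def vanishes_def eval_xy_conv_poly2)
  \<comment> \<open>The minimality of the order enters here: the generator \<open>h\<close> divides
    \<open>P - c0\<close> and has total degree at least \<open>n\<close>, so the two divide each
    other.\<close>
  then have "n \<le> total_degree h"
    using \<open>curve_order \<Gamma> = n\<close> unfolding curve_order_def by (blast intro: Least_le)
  then have "?Q dvd G"
    using dvd_of_minimal_total_degree[OF hom _ h(3)[OF Q(2)]] \<open>n > 2\<close> h(3)[OF \<open>vanishes \<Gamma> G\<close>]
    by (auto intro: dvd_trans)

  \<comment> \<open>Comparison of homogeneous parts\<close>
  have "degree F1 \<le> n + k" "degree F2 \<le> n + k" using deg by auto
  note identity = leading_part_identity[OF hom \<open>?Q dvd G\<close> G this \<open>k < n\<close>]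
  have "coeff F1 (n + k) \<noteq> 0 \<or> coeff F2 (n + k) \<noteq> 0"
  proof -
    have "F \<noteq> 0" if "degree F = n + k" for F :: "complex poly" using that \<open>k < n\<close> by auto
    then show ?thesis using deg by (metis leading_coeff_0_iff max_def)
  qed
  \<comment> \<open>This is \<open>P\<close> in the coordinates \<open>u = x + \<i> y\<close>,
    \<open>v = x + \<beta>' y\<close>; the system can be solved for \<open>x\<close>,
    \<open>y\<close> because \<open>\<beta> \<noteq> 1\<close>.\<close>
  define f where "f = (\<lambda>u v. let y = (u - v) / (\<i> - \<beta>') in poly2 P (u - \<i> * y) y)"
  have \<beta>': "\<i> - \<beta>' \<noteq> 0" using \<open>0 < \<beta>\<close> \<open>\<beta> < 1\<close> by (simp add: \<beta>'_def field_simps)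
  have "\<exists>C. (\<forall>u v. u \<noteq> 0 \<longrightarrow> f u v = C * u ^ n) \<or> (\<forall>u v. v \<noteq> 0 \<longrightarrow> f u v = C * v ^ n)"
  proof (rule cofactor_of_binomial)
    fix u v
    define y where "y = (u - v) / (\<i> - \<beta>')"
    have "(\<i> - \<beta>') * y = u - v" using \<beta>' by (simp add: y_def)
    moreover have "f u v = poly2 P (u - \<i> * y) y" by (simp add: f_def y_def Let_def)
    ultimately have "u - \<i> * y + \<beta>' * y = v" "f u v = poly2 P (u - \<i> * y) y"
      by (simp_all add: algebra_simps)
    then show "c0 * (coeff F1 (n + k) * u ^ (n + k) - coeff F2 (n + k) * v ^ (n + k))
        = - f u v * (coeff F1 k * u ^ k - coeff F2 k * v ^ k)"
      using identity[of "u - \<i> * y" y] by simp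
  qed fact+
  then obtain C where C: "(\<forall>u v. u \<noteq> 0 \<longrightarrow> f u v = C * u ^ n) \<or> (\<forall>u v. v \<noteq> 0 \<longrightarrow> f u v = C * v ^ n)"
    by blast
  \<comment> \<open>At a point \<open>z\<close> of the plane the coordinates are
    \<open>u = z\<close> and \<open>v = T_beta \<beta> z\<close>.\<close>
  have f: "f z (T_beta \<beta> z) = c0" if "z \<in> \<Gamma>" for z
  proof -
    have "z - T_beta \<beta> z = (\<i> - \<beta>') * Im z"
      by (subst complex_eq[of z]) (simp add: T algebra_simps)
    then have y: "(z - T_beta \<beta> z) / (\<i> - \<beta>') = Im z" using \<beta>' by simp
    have "z - \<i> * Im z = Re z" by (subst complex_eq[of z]) simp
    then show ?thesis using Q0[OF that] by (simp only: f_def Let_def y)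
  qed
  have injT: "inj (T_beta \<beta>)" using \<open>0 < \<beta>\<close> by (intro inj_T_beta) simp
  have T0: "T_beta \<beta> z = 0 \<longleftrightarrow> z = 0" for z
    using \<open>0 < \<beta>\<close> by (auto simp: T_beta_def complex_eq_iff)
  \<comment> \<open>The origin is added because the formulas for \<open>f\<close> leave out
    \<open>u = 0\<close> or \<open>v = 0\<close>.\<close>
  have "\<Gamma> \<subseteq> {0} \<union> {z. C * z ^ n = c0} \<or> \<Gamma> \<subseteq> {0} \<union> {z. C * T_beta \<beta> z ^ n = c0}"
    using C
  proof (elim disj_forward)
    assume C: "\<forall>u v. u \<noteq> 0 \<longrightarrow> f u v = C * u ^ n"
    have "C * z ^ n = c0" if "z \<in> \<Gamma>" "z \<noteq> 0" for z
      using that C f[of z] by metis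
    then show "\<Gamma> \<subseteq> {0} \<union> {z. C * z ^ n = c0}" by blast
  next
    assume C: "\<forall>u v. v \<noteq> 0 \<longrightarrow> f u v = C * v ^ n"
    have "C * T_beta \<beta> z ^ n = c0" if "z \<in> \<Gamma>" "z \<noteq> 0" for z
      using that C f[of z] T0 by metis
    then show "\<Gamma> \<subseteq> {0} \<union> {z. C * T_beta \<beta> z ^ n = c0}" by blast
  qed
  moreover have "finite ({0} \<union> {z. C * z ^ n = c0})" "finite ({0} \<union> {z. C * T_beta \<beta> z ^ n = c0})"
    using finite_power_level[of n c0 "\<lambda>z. z" C] finite_power_level[of n c0 "T_beta \<beta>" C]
      \<open>n > 2\<close> \<open>c0 \<noteq> 0\<close> injT by auto
  ultimately show False using inf finite_subset by blast
qed

end
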